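(* Let $n,k,\ell\ge 1$ be integers and let $\mathcal{P}_1,\mathcal{P}_2,\dots,\mathcal{P}_\ell$ be labeled sets of $n$ points each, in general position in the plane (each labeled bijectively by $\{1,\dots,n\}$). If $n\ge k^{\ell}+2k-1$, then any maximal compatible matching for $\mathcal{P}_1,\dots,\mathcal{P}_\ell$ consists of at least $k$ edges.
   Context: A point set in the plane is in general position if no three of its points are collinear. A matching is a set of pairwise disjoint 2-element subsets (edges) of the label set $\{1,\dots,n\}$. It is compatible to several labeled point sets if, on each of them, its straight-line drawing (edge $\{a,b\}$ drawn as the segment between the points labeled $a$ and $b$) is crossing-free. A compatible matching is maximal if no further edge can be added to it so that it remains a compatible matching (inclusion-wise maximal). *)

theory Defs
  imports "HOL-Analysis.Analysis"
begin

definition general_position :: "(real ^ 2) set \<Rightarrow> bool" where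
  "general_position S \<longleftrightarrow> (\<forall>T \<subseteq> S. card T = 3 \<longrightarrow> \<not> collinear T)"

definition matching :: "nat \<Rightarrow> nat set set \<Rightarrow> bool" where
  "matching n M \<longleftrightarrow> (\<forall>e \<in> M. e \<subseteq> {1..n} \<and> card e = 2) \<and> pairwise disjnt M"

(* p maps each label to its point. Two edges may meet only in the points of labels they share;
   the edges of a matching share none, so their closed segments have to be disjoint. *)
definition crossing_free :: "(nat \<Rightarrow> real ^ 2) \<Rightarrow> nat set set \<Rightarrow> bool" where
  "crossing_free p M \<longleftrightarrow>
     (\<forall>a b c d. {a, b} \<in> M \<and> {c, d} \<in> M \<and> {a, b} \<noteq> {c, d} \<longrightarrow>
        closed_segment (p a) (p b) \<inter> closed_segment (p c) (p d) \<subseteq> p ` ({a, b} \<inter> {c, d}))"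

definition compatible_matching ::
    "nat \<Rightarrow> nat \<Rightarrow> (nat \<Rightarrow> nat \<Rightarrow> real ^ 2) \<Rightarrow> nat set set \<Rightarrow> bool" where
  "compatible_matching n l p M \<longleftrightarrow> matching n M \<and> (\<forall>i \<in> {1..l}. crossing_free (p i) M)"

definition maximal_compatible_matching ::
    "nat \<Rightarrow> nat \<Rightarrow> (nat \<Rightarrow> nat \<Rightarrow> real ^ 2) \<Rightarrow> nat set set \<Rightarrow> bool" where
  "maximal_compatible_matching n l p M \<longleftrightarrow>
     compatible_matching n l p M \<and>
     (\<forall>e. e \<notin> M \<longrightarrow> \<not> compatible_matching n l p (insert e M))"

end

theory Submission
  imports Defs
begin

text \<open>
  If \<open>M\<close> has \<open>m\<close> edges, extending its segments on one drawing until they hit each other splits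
  the plane into \<open>m + 1\<close> convex cells. If \<open>m < k\<close>, more than \<open>k ^ l\<close> labels are unmatched, while there
  are at most \<open>(m + 1) ^ l \<le> k ^ l\<close> tuples of cells, so two unmatched labels share a cell in every
  drawing, and by convexity their edge can be added to \<open>M\<close>.

  To count the cells without planar topology, sweep the drawing upwards by a horizontal line, in
  coordinates where all heights are distinct. At the lower endpoint of a segment the one cell
  containing it is cut along the line through the segment, also below the endpoint, where this cell
  contains no obstacle: this is the only event that creates a cell. Upper ends are extended
  straight up; when two lines meet, one whose segment has already ended stops.
\<close>

section \<open>Separating finite sets of reals and gluing convex sets\<close>

text \<open>Used to place a base point between the lines that must lie left of it and those that
  must lie right of it; in the outermost gaps one of the two sets is empty.\<close>

lemma between_finite:
  fixes L R :: "real set"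
  assumes "finite L" "finite R" "\<And>l r. l \<in> L \<Longrightarrow> r \<in> R \<Longrightarrow> l < r"
  obtains x where "\<And>l. l \<in> L \<Longrightarrow> l < x" "\<And>r. r \<in> R \<Longrightarrow> x < r"
proof -
  consider "L = {}" | "R = {}" | "L \<noteq> {}" "R \<noteq> {}" by blast
  then show thesis
  proof cases
    case 1
    have "Min (insert 0 R) \<le> r" if "r \<in> R" for r using assms(2) that by simp
    then show thesis using 1 by (intro that[of "Min (insert 0 R) - 1"]) force+
  next
    case 2
    have "l \<le> Max (insert 0 L)" if "l \<in> L" for l using assms(1) that by simp
    then show thesis using 2 by (intro that[of "Max (insert 0 L) + 1"]) force+
  next
    case 3
    then have "Max L < Min R" using assms by simp
    then obtain x where "Max L < x" "x < Min R" using dense by blast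
    with that[of x] assms 3 show thesis by simp
  qed
qed

text \<open>Only segments from \<open>K\<close> to \<open>G\<close> need care. Such a segment passes
  height \<open>h\<close> in a point that \<open>cross\<close> puts into \<open>K\<close> and
  \<open>level\<close> into \<open>G\<close>, so one half stays in \<open>K\<close> and the other in
  \<open>G\<close>.\<close>

lemma convex_glue:
  assumes "convex K" "convex G"
    and K: "\<And>z y. (z, y) \<in> K \<Longrightarrow> y \<le> h" and G: "\<And>z y. (z, y) \<in> G \<Longrightarrow> h \<le> y"
    and level: "\<And>z::real. (z, h) \<in> K \<longleftrightarrow> (z, h) \<in> G"
    and cross: "\<And>z y z' y' t. (z, y) \<in> K \<Longrightarrow> (z', y') \<in> G \<Longrightarrow> 0 < t \<Longrightarrow> t < 1 \<Longrightarrow>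
      (1 - t) * y + t * y' = h \<Longrightarrow> ((1 - t) * z + t * z', h) \<in> K"
  shows "convex (K \<union> G)"
proof -
  have mixed: "closed_segment p q \<subseteq> K \<union> G" if "p \<in> K" "q \<in> G" for p q
  proof -
    obtain z y z' y' where pq: "p = (z, y)" "q = (z', y')" by (metis surj_pair)
    have "y \<le> h" "h \<le> y'" using K G that pq by auto
    then consider "y = h" | "y' = h" | "y < h" "h < y'" by linarith
    then show ?thesis
    proof cases
      case 1
      then have "p \<in> G" using level that pq by blast
      then show ?thesis using assms(2) that by (auto simp: convex_contains_segment)
    next
      case 2
      then have "q \<in> K" using level that pq by blast
      then show ?thesis using assms(1) that by (auto simp: convex_contains_segment)
    next
      case 3
      \<comment> \<open>The parameter at which the segment from \<open>p\<close> to \<open>q\<close>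
        reaches height \<open>h\<close>.\<close>
      define t where "t = (h - y) / (y' - y)"
      have t: "0 < t" "t < 1" using 3 by (auto simp: t_def field_simps)
      have th: "(1 - t) * y + t * y' = h"
      proof -
        have "t * (y' - y) = h - y" using 3 by (simp add: t_def)
        then show ?thesis by (simp add: algebra_simps)
      qed
      define m where "m = ((1 - t) * z + t * z', h)"
      have m: "m \<in> K" "m \<in> G" using cross[OF _ _ t th] that pq level by (auto simp: m_def)
      have "m \<in> closed_segment p q" using t th
        by (auto simp: in_segment m_def pq intro!: exI[of _ t])
      then have "closed_segment p q = closed_segment p m \<union> closed_segment m q"
        by (simp add: Un_closed_segment)
      then show ?thesis using m that assms(1,2) unfolding convex_contains_segment by blast
    qed
  qed
  show ?thesis unfolding convex_contains_segment
  proof (intro ballI)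
    fix p q assume "p \<in> K \<union> G" "q \<in> K \<union> G"
    then show "closed_segment p q \<subseteq> K \<union> G"
      using mixed[of p q] mixed[of q p] assms(1,2)
      unfolding convex_contains_segment closed_segment_commute[of q p] by blast
  qed
qed

section \<open>Lines as functions of the height, and the gaps between them\<close>

text \<open>Line \<open>i\<close> is \<open>x = al i + be i * y\<close>; points of the plane are pairs \<open>(x, y)\<close> with \<open>y\<close> the
  height of the sweep line.\<close>
locale lines =
  fixes al be :: "'i \<Rightarrow> real"
begin

definition line :: "'i \<Rightarrow> real \<Rightarrow> real" where
  "line i y = al i + be i * y"

definition off :: "'i set \<Rightarrow> real \<Rightarrow> real \<Rightarrow> bool" where
  "off A h x \<longleftrightarrow> (\<forall>i\<in>A. x \<noteq> line i h)"

text \<open>On points off \<open>A\<close> the classes are the open intervals between consecutive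
  lines at height \<open>h\<close>. Comparing signs avoids sorting the lines.\<close>

definition same_gap :: "'i set \<Rightarrow> real \<Rightarrow> real \<Rightarrow> real \<Rightarrow> bool" where
  "same_gap A h x x' \<longleftrightarrow> (\<forall>i\<in>A. sgn (x - line i h) = sgn (x' - line i h))"

text \<open>For \<open>x\<close> off \<open>A\<close> these are the nearest line on the left and the
  nearest on the right, so they bound the gap of \<open>x\<close>; an outermost gap has none on one
  side.\<close>

definition nbr :: "'i set \<Rightarrow> real \<Rightarrow> real \<Rightarrow> 'i \<Rightarrow> bool" where
  "nbr A h x i \<longleftrightarrow> i \<in> A \<and>
     (\<forall>j\<in>A. sgn (line j h - x) = sgn (line i h - x) \<longrightarrow> \<bar>line i h - x\<bar> \<le> \<bar>line j h - x\<bar>)"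

lemma same_gap_refl [simp]: "same_gap A h x x"
  by (simp add: same_gap_def)

lemma same_gap_sym: "same_gap A h x x' \<Longrightarrow> same_gap A h x' x"
  by (simp add: same_gap_def)

lemma same_gap_trans: "same_gap A h x y \<Longrightarrow> same_gap A h y z \<Longrightarrow> same_gap A h x z"
  by (simp add: same_gap_def)

lemma same_gap_off: "same_gap A h x x' \<Longrightarrow> off A h x \<Longrightarrow> off A h x'"
  by (force simp: same_gap_def off_def sgn_if split: if_splits)

text \<open>Some line of \<open>A\<close> separates \<open>x\<close> from \<open>c\<close>. The line
  nearest to \<open>x\<close> on the same side is a neighbour, and \<open>c\<close> is not on the
  side of it where \<open>x\<close> is.\<close>

lemma nbr_separates:
  assumes "finite A" "off A h x" "\<not> same_gap A h x c"
  obtains i where "nbr A h x i" "sgn (x - line i h) \<noteq> sgn (c - line i h)"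
proof -
  obtain j where j: "j \<in> A" "sgn (x - line j h) \<noteq> sgn (c - line j h)"
    using assms(3) by (auto simp: same_gap_def)
  define S where "S = {i\<in>A. sgn (line i h - x) = sgn (line j h - x)}"
  have "finite S" "j \<in> S" using assms(1) j by (auto simp: S_def)
  then obtain i where i: "i \<in> S" "\<And>i'. i' \<in> S \<Longrightarrow> \<bar>line i h - x\<bar> \<le> \<bar>line i' h - x\<bar>"
    using arg_min_if_finite[of S "\<lambda>i. \<bar>line i h - x\<bar>"] by (metis empty_iff not_le)
  have "nbr A h x i" using i by (auto simp: nbr_def S_def)
  moreover have "sgn (x - line i h) \<noteq> sgn (c - line i h)"
    using i(2)[OF \<open>j \<in> S\<close>] i(1) j assms(2)
    by (auto simp: S_def off_def sgn_if abs_if split: if_splits)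
  ultimately show thesis using that by blast
qed

lemma line_affine: "line i ((1 - t) * y + t * y') = (1 - t) * line i y + t * line i y'"
  by (simp add: line_def algebra_simps)

lemma convex_side: "convex {(z, y). sgn (z - line i y) = c}"
proof -
  \<comment> \<open>This makes \<open>z - line i y\<close> affine in \<open>(z, y)\<close>: its sign
    classes are open half-planes, a line, or empty if \<open>c\<close> is no value of
    \<open>sgn\<close>.\<close>
  have *: "z - line i y = (1, - be i) \<bullet> (z, y) - al i" for z y
    by (simp add: line_def)
  consider "c = 1" | "c = -1" | "c = 0" | "\<And>x. sgn x \<noteq> (c::real)"
    by (metis sgn_if)
  then show ?thesis
  proof cases
    case 1
    then have "{(z, y). sgn (z - line i y) = c} = {p. (1, - be i) \<bullet> p > al i}"
      unfolding * by (auto simp: sgn_if)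
    then show ?thesis by (simp add: convex_halfspace_gt)
  next
    case 2
    then have "{(z, y). sgn (z - line i y) = c} = {p. (1, - be i) \<bullet> p < al i}"
      unfolding * by (auto simp: sgn_if split: if_splits)
    then show ?thesis by (simp add: convex_halfspace_lt)
  next
    case 3
    then have "{(z, y). sgn (z - line i y) = c} = {p. (1, - be i) \<bullet> p = al i}"
      unfolding * by (auto simp: sgn_if split: if_splits)
    then show ?thesis by (simp add: convex_hyperplane)
  next
    case 4
    then have "{(z, y). sgn (z - line i y) = c} = {}" by auto
    then show ?thesis by simp
  qed
qed

lemma convex_sides: "convex {(z, y). \<forall>i\<in>A. sgn (z - line i y) = c i}"
proof -
  have "{(z, y). \<forall>i\<in>A. sgn (z - line i y) = c i} = (\<Inter>i\<in>A. {(z, y). sgn (z - line i y) = c i})"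
    by auto
  then show ?thesis by (auto intro!: convex_INT convex_side)
qed

lemma convex_strip: "convex {(z::real, y::real). h \<le> y \<and> y \<le> h'}"
proof -
  have "{(z::real, y::real). h \<le> y \<and> y \<le> h'}
      = {p. (0, 1) \<bullet> p \<ge> h} \<inter> {p. (0, 1) \<bullet> p \<le> h'}" by auto
  then show ?thesis
    by (simp add: convex_Int convex_halfspace_ge convex_halfspace_le)
qed

text \<open>The difference of two lines is continuous in the height, so by the intermediate value
  theorem it changes sign only through a zero.\<close>

lemma order_preserved:
  assumes "h \<le> y" "\<And>y'. h \<le> y' \<Longrightarrow> y' \<le> y \<Longrightarrow> line i y' \<noteq> line j y'"
  shows "sgn (line i h - line j h) = sgn (line i y - line j y)"
proof (rule ccontr)
  assume *: "sgn (line i h - line j h) \<noteq> sgn (line i y - line j y)"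
  define g where "g = (\<lambda>y. line i y - line j y)"
  have cont: "continuous_on {h..y} g"
    unfolding g_def line_def by (intro continuous_intros)
  have "g h \<noteq> 0" "g y \<noteq> 0" using assms by (auto simp: g_def)
  then consider "g h \<le> 0" "0 \<le> g y" | "g y \<le> 0" "0 \<le> g h"
    using * by (fastforce simp: g_def sgn_if split: if_splits)
  then have "\<exists>x\<ge>h. x \<le> y \<and> g x = 0"
  proof cases
    case 1 then show ?thesis using IVT'[of g h 0 y] cont assms(1) by auto
  next
    case 2 then show ?thesis using IVT2'[of g y 0 h] cont assms(1) by auto
  qed
  then show False using assms(2) by (auto simp: g_def)
qed

text \<open>The difference of the two lines is a multiple of \<open>y - w\<close>, hence it vanishes
  at \<open>w\<close> and has opposite signs below and above.\<close>

lemma order_swapped: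
  assumes "line i w = line j w" "h < w" "w \<le> y"
  shows "sgn (line i y - line j y) = 0 \<or> sgn (line i y - line j y) = - sgn (line i h - line j h)"
proof -
  have 1: "line i y - line j y = (be i - be j) * (y - w)"
    using assms(1) by (simp add: line_def algebra_simps)
  have 2: "line i h - line j h = - ((be i - be j) * (w - h))"
    using assms(1) by (simp add: line_def algebra_simps)
  show ?thesis unfolding 1 2 using assms(2,3)
    by (cases "y = w") (simp_all add: sgn_mult sgn_minus)
qed

text \<open>A move by less than the distance to every line of \<open>A\<close> stays in the gap.
  This gives base points on a prescribed side of a line that runs inside the gap.\<close>

lemma off_point_near:
  assumes "finite A" "off A h c" "\<sigma> = 1 \<or> \<sigma> = -1"
  obtains x where "same_gap A h x c" "sgn (x - c) = (\<sigma>::real)"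
proof -
  obtain e where e: "e > 0" "\<And>i. i \<in> A \<Longrightarrow> e < \<bar>line i h - c\<bar>"
  proof -
    define d where "d = Min (insert 1 ((\<lambda>i. \<bar>line i h - c\<bar>) ` A))"
    have "d > 0" using assms(1,2) by (auto simp: d_def off_def)
    moreover have "d \<le> \<bar>line i h - c\<bar>" if "i \<in> A" for i
      unfolding d_def using assms(1) that by (intro Min_le) auto
    ultimately show thesis by (intro that[of "d / 2"]) force+
  qed
  show thesis
  proof (rule that[of "c + \<sigma> * e"])
    show "same_gap A h (c + \<sigma> * e) c" unfolding same_gap_def
    proof
      fix i assume "i \<in> A"
      then show "sgn (c + \<sigma> * e - line i h) = sgn (c - line i h)"
        using e(1) e(2)[of i] assms(3) by (auto simp: sgn_if)
    qed
  qed (use assms(3) e(1) in auto)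
qed

end

section \<open>Cells in a strip where no segment starts\<close>

text \<open>Cells of the strip \<open>h \<le> y \<le> h'\<close> in which no segment starts: the lines in \<open>A\<close> carry segments
  reaching down to height \<open>h\<close> or below, with upper ends at the heights \<open>b\<close>, or extensions of
  such segments, and those in \<open>B\<close> reach height \<open>h'\<close>. \<open>G x\<close> is the cell above the gap of \<open>A\<close> at
  height \<open>h\<close> that contains \<open>x\<close>.\<close>
locale strip_cells = lines al be for al be :: "'i \<Rightarrow> real" +
  fixes b :: "'i \<Rightarrow> real" and A :: "'i set" and h h' :: real
    and B :: "'i set" and G :: "real \<Rightarrow> (real \<times> real) set"
  assumes survivors: "B \<subseteq> A" "{i\<in>A. h' \<le> b i} \<subseteq> B"
    and distinct_top: "i \<in> B \<Longrightarrow> j \<in> B \<Longrightarrow> i \<noteq> j \<Longrightarrow> line i h' \<noteq> line j h'"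
    and convex_cell: "off A h x \<Longrightarrow> convex (G x)"
    and in_strip: "off A h x \<Longrightarrow> (z, y) \<in> G x \<Longrightarrow> h \<le> y \<and> y \<le> h'"
    and bottom: "off A h x \<Longrightarrow> (x', h) \<in> G x \<longleftrightarrow> same_gap A h x x'"
    and avoids: "off A h x \<Longrightarrow> i \<in> A \<Longrightarrow> h \<le> y \<Longrightarrow> y \<le> h' \<Longrightarrow> y \<le> b i \<Longrightarrow> (line i y, y) \<notin> G x"
    and avoids_survivor: "off A h x \<Longrightarrow> i \<in> B \<Longrightarrow> h \<le> y \<Longrightarrow> y \<le> h' \<Longrightarrow> (line i y, y) \<notin> G x"
    and top: "off A h x \<Longrightarrow> (x', h') \<in> G x \<Longrightarrow> (x'', h') \<in> G x \<longleftrightarrow> same_gap B h' x' x''"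
    and nbr_side: "off A h x \<Longrightarrow> nbr A h x i \<Longrightarrow> (z, y) \<in> G x \<Longrightarrow>
      sgn (z - line i y) = sgn (x - line i h)"
    and gap_cong: "off A h x \<Longrightarrow> same_gap A h x x' \<Longrightarrow> G x = G x'"
    and separated: "off A h x \<Longrightarrow> off A h x' \<Longrightarrow> q \<in> G x \<Longrightarrow> q \<in> G x' \<Longrightarrow> same_gap A h x x'"
    and covers: "h \<le> y \<Longrightarrow> y \<le> h' \<Longrightarrow> off A y z \<Longrightarrow> \<exists>x. off A h x \<and> (z, y) \<in> G x"
    and covers_top: "off B h' z \<Longrightarrow> \<exists>x. off A h x \<and> (z, h') \<in> G x"

context lines begin

text \<open>Lines that never meet keep their order through the whole strip, so each gap at height
  \<open>h\<close> carries exactly the region on the same side of every line.\<close>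

lemma strip_cells_no_meeting:
  assumes "finite A" "h \<le> h'"
    and "\<And>i j y. i \<in> A \<Longrightarrow> j \<in> A \<Longrightarrow> i \<noteq> j \<Longrightarrow> h \<le> y \<Longrightarrow> y \<le> h' \<Longrightarrow> line i y \<noteq> line j y"
  shows "strip_cells al be b A h h' A
    (\<lambda>x. {(z, y). h \<le> y \<and> y \<le> h'} \<inter> {(z, y). \<forall>i\<in>A. sgn (z - line i y) = sgn (x - line i h)})"
proof -
  have cover: "\<exists>x. off A h x \<and>
      (z, y) \<in> {(z, y). h \<le> y \<and> y \<le> h'} \<inter> {(z, y). \<forall>i\<in>A. sgn (z - line i y) = sgn (x - line i h)}"
    if 13: "h \<le> y" "y \<le> h'" "off A y z" for y z
  proof -
  \<comment> \<open>The positions at height \<open>h\<close> of the lines that pass left of the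
    given point, and below those that pass right of it; the preserved order makes every
    \<open>L\<close> smaller than every \<open>R\<close>.\<close>
  define L where "L = (\<lambda>i. line i h) ` {i\<in>A. line i y < z}"
  define R where "R = (\<lambda>i. line i h) ` {i\<in>A. z < line i y}"
  have "finite L" "finite R" using assms(1) by (auto simp: L_def R_def)
  moreover have "l < r" if lr: "l \<in> L" "r \<in> R" for l r
  proof -
    obtain i j where ij: "i \<in> A" "j \<in> A" "line i y < z" "z < line j y" "l = line i h" "r = line j h"
      using lr unfolding L_def R_def by blast
    have "sgn (line i h - line j h) = sgn (line i y - line j y)"
    proof (rule order_preserved)
      show "line i y' \<noteq> line j y'" if "h \<le> y'" "y' \<le> y" for y'
        using assms(3)[of i j y'] that 13 ij by force
    qed (use 13 in simp)
    then show ?thesis using ij by (auto simp: sgn_if split: if_splits)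
  qed
  ultimately obtain x where x: "\<And>l. l \<in> L \<Longrightarrow> l < x" "\<And>r. r \<in> R \<Longrightarrow> x < r"
    using between_finite by blast
  have "sgn (z - line i y) = sgn (x - line i h) \<and> x \<noteq> line i h" if "i \<in> A" for i
  proof (cases "line i y < z")
    case True
    then have "line i h < x" using x(1) that by (auto simp: L_def)
    with True show ?thesis by simp
  next
    case False
    then have "z < line i y" using 13(3) that by (force simp: off_def)
    then have "x < line i h" using x(2) that by (auto simp: R_def)
    with \<open>z < line i y\<close> show ?thesis by simp
  qed
  then show ?thesis using 13 by (auto simp: off_def intro!: exI[of _ x])
  qed
  show ?thesis
  proof (unfold_locales, goal_cases)
    case (4 x) show ?case by (intro convex_Int convex_strip convex_sides)
  next
    case (13 y z) then show ?case by (rule cover)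
  next
    case (14 z) then show ?case using assms(2) by (intro cover) auto
  next
    case (7 x i y)
    then have "sgn (x - line i h) \<noteq> 0" by (simp add: off_def sgn_zero_iff)
    then show ?case using 7(2) by (auto intro!: bexI[of _ i])
  next
    case (8 x i y)
    then have "sgn (x - line i h) \<noteq> 0" by (simp add: off_def sgn_zero_iff)
    then show ?case using 8(2) by (auto intro!: bexI[of _ i])
  qed (use assms in \<open>auto simp: same_gap_def nbr_def off_def\<close>)
qed

lemma nbr_cong:
  assumes "nbr A h x i" "same_gap A h x x'"
  shows "nbr A h x' i"
  unfolding nbr_def
proof (intro conjI ballI impI)
  show "i \<in> A" using assms by (simp add: nbr_def)
  then have "sgn (x - line i h) = sgn (x' - line i h)" using assms by (simp add: same_gap_def)
  fix j assume j: "j \<in> A" "sgn (line j h - x') = sgn (line i h - x')"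
  moreover have "sgn (x - line j h) = sgn (x' - line j h)" using j assms by (simp add: same_gap_def)
  moreover have "sgn (line j h - x) = sgn (line i h - x) \<longrightarrow> \<bar>line i h - x\<bar> \<le> \<bar>line j h - x\<bar>"
    using assms j by (simp add: nbr_def)
  ultimately show "\<bar>line i h - x'\<bar> \<le> \<bar>line j h - x'\<bar>"
    using \<open>sgn (x - line i h) = sgn (x' - line i h)\<close>
    by (auto simp: sgn_if abs_if split: if_splits)
qed

lemma same_side:
  assumes "off A h x" "off A h c" "same_gap A h x x'" "\<not> same_gap A h x c"
  shows "sgn (x - c) = sgn (x' - c)"
proof -
  obtain i where i: "i \<in> A" "sgn (x - line i h) \<noteq> sgn (c - line i h)"
    using assms(4) by (auto simp: same_gap_def)
  have "sgn (x - line i h) = sgn (x' - line i h)" "x \<noteq> line i h" "c \<noteq> line i h"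
    using assms i by (auto simp: same_gap_def off_def)
  then show ?thesis using i by (auto simp: sgn_if split: if_splits)
qed

text \<open>A line between \<open>x\<close> and \<open>r\<close> would be nearer to \<open>x\<close>
  than its neighbour \<open>r\<close>.\<close>

lemma nbr_imp_same:
  assumes "nbr (insert r A) h x r" "off (insert r A) h x" "off A h (line r h)"
  shows "same_gap A h x (line r h)"
proof (rule ccontr)
  assume "\<not> same_gap A h x (line r h)"
  then obtain j where j: "j \<in> A" "sgn (x - line j h) \<noteq> sgn (line r h - line j h)"
    by (auto simp: same_gap_def)
  have "x \<noteq> line j h" "x \<noteq> line r h" "line r h \<noteq> line j h" using j assms by (auto simp: off_def)
  moreover have "sgn (line j h - x) = sgn (line r h - x) \<longrightarrow> \<bar>line r h - x\<bar> \<le> \<bar>line j h - x\<bar>"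
    using assms j by (simp add: nbr_def)
  ultimately show False using j(2) by (auto simp: sgn_if abs_if split: if_splits)
qed

text \<open>The line \<open>r\<close> is stopped at height \<open>w\<close> by its neighbour \<open>c\<close>. Cells for the other lines are cut along
  the whole of \<open>r\<close> within the gap containing it: above \<open>w\<close> that gap already lies on one side of
  \<open>r\<close>, since \<open>c\<close> bounds it.\<close>
lemma strip_cells_insert:
  assumes "finite A" "r \<in> A" and w: "line r w = line c w" "h < w" "w \<le> h'" "b r < w"
    and distinct: "\<And>i j. i \<in> A \<Longrightarrow> j \<in> A \<Longrightarrow> i \<noteq> j \<Longrightarrow> line i h \<noteq> line j h"
    and no_meeting: "\<And>i y. i \<in> A \<Longrightarrow> i \<noteq> r \<Longrightarrow> h \<le> y \<Longrightarrow> y < w \<Longrightarrow> line i y \<noteq> line r y"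
    and c: "nbr (A - {r}) h (line r h) c"
    and G: "strip_cells al be b (A - {r}) h h' B G"
  shows "strip_cells al be b A h h' B
    (\<lambda>x. if same_gap (A - {r}) h x (line r h)
         then G x \<inter> {(z, y). sgn (z - line r y) = sgn (x - line r h)} else G x)"
    (is "strip_cells _ _ _ _ _ _ _ ?G")
proof -
  interpret G: strip_cells al be b "A - {r}" h h' B G by (rule G)
  have sub: "?G x \<subseteq> G x" for x by auto
  have same_A: "same_gap A h x x' \<longleftrightarrow> same_gap (A - {r}) h x x' \<and> sgn (x - line r h) = sgn (x' - line r h)" for x x'
    using assms(2) by (auto simp: same_gap_def)
  have off_A: "off A h x \<longleftrightarrow> off (A - {r}) h x \<and> x \<noteq> line r h" for x
    using assms(2) by (auto simp: off_def)
  have off_r: "off (A - {r}) h (line r h)"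
    using distinct assms(2) by (fastforce simp: off_def)
  note same_side = same_side[OF _ off_r]
  \<comment> \<open>The side of \<open>c\<close> on which \<open>r\<close> runs below
    \<open>w\<close>. From \<open>w\<close> on, \<open>r\<close> is on \<open>c\<close> or across
    it, so the gap lies entirely on side \<open>\<sigma>\<close> of \<open>r\<close>, which is the
    claim \<open>live\<close>.\<close>
  define \<sigma> where "\<sigma> = sgn (line r h - line c h)"
  have \<sigma>: "\<sigma> = 1 \<or> \<sigma> = -1"
    using distinct[of r c] assms(2) c by (auto simp: \<sigma>_def nbr_def sgn_if)
  have live: "sgn (z - line r y) = \<sigma>"
    if x: "off (A - {r}) h x" "same_gap (A - {r}) h x (line r h)" and zy: "(z, y) \<in> G x" "w \<le> y" for x z y
  proof -
    have "nbr (A - {r}) h x c" by (rule nbr_cong[OF c same_gap_sym[OF x(2)]])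
    then have "sgn (z - line c y) = sgn (x - line c h)" using G.nbr_side x zy by blast
    also have "\<dots> = \<sigma>" using x c by (auto simp: same_gap_def nbr_def \<sigma>_def)
    finally show ?thesis
      using order_swapped[OF w(1,2) zy(2)] \<sigma> unfolding \<sigma>_def[symmetric]
      by (auto simp: sgn_if split: if_splits)
  qed
  \<comment> \<open>Of the two halves of the cut cell only the one on side \<open>\<sigma>\<close>
    reaches the top, and there it has lost nothing.\<close>
  have top_cell: "G x \<inter> {(z, y). y = h'} \<subseteq> ?G x" if "off (A - {r}) h x" "sgn (x - line r h) = \<sigma>" for x
    using live[OF that(1)] that(2) w(3) by auto
  show ?thesis
  proof (unfold_locales, goal_cases)
    case 1 then show ?case using G.survivors by auto
  next
    case 2 then show ?case using G.survivors w by auto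
  next
    case (3 i j) then show ?case by (rule G.distinct_top)
  next
    case (4 x) then show ?case using G.convex_cell[of x]
      by (auto simp: off_A intro!: convex_Int convex_side)
  next
    case (5 x z y) then show ?case using G.in_strip[of x z y] sub[of x] by (auto simp: off_A)
  next
    case (6 x x')
    then show ?case using G.bottom[of x x'] same_side[of x x'] by (auto simp: off_A same_A)
  next
    case (7 x i y)
    have off: "off (A - {r}) h x" using 7 by (simp add: off_A)
    show ?case
    proof (cases "i = r")
      case False
      then have "(line i y, y) \<notin> G x" using 7 off by (intro G.avoids) auto
      then show ?thesis using sub[of x] by blast
    next
      case True
      show ?thesis
      proof (cases "same_gap (A - {r}) h x (line r h)")
        case same_gap: True
        have "sgn (x - line r h) \<noteq> 0" using 7(1) by (simp add: off_A sgn_zero_iff)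
        then show ?thesis using same_gap True by auto
      next
        case False
        \<comment> \<open>The gap of \<open>x\<close> does not contain \<open>r\<close>, so a
          neighbour \<open>j\<close> of \<open>x\<close> separates them. Up to
          \<open>b r < w\<close> the line \<open>r\<close> does not meet \<open>j\<close>, while the
          cell never crosses \<open>j\<close>.\<close>
        obtain j where j: "nbr (A - {r}) h x j" "sgn (x - line j h) \<noteq> sgn (line r h - line j h)"
          using nbr_separates[OF _ off False] assms(1) by blast
        have "sgn (line r h - line j h) = sgn (line r y - line j y)"
          by (rule order_preserved) (use no_meeting[of j] 7 w True j in \<open>force simp: nbr_def\<close>)+
        then have "(line r y, y) \<notin> G x" using G.nbr_side[OF off j(1)] j(2) by metis
        then show ?thesis using False True by simp
      qed
    qed
  next
    case (8 x i y)
    then have "(line i y, y) \<notin> G x" by (intro G.avoids_survivor) (auto simp: off_A)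
    then show ?case using sub[of x] by blast
  next
    case (9 x x' x'')
    have off: "off (A - {r}) h x" using 9 by (simp add: off_A)
    have *: "(x', h') \<in> G x" using 9 sub[of x] by blast
    show ?case
    proof (cases "same_gap (A - {r}) h x (line r h)")
      case True
      then have "sgn (x - line r h) = \<sigma>" using live[OF off True * w(3)] 9(2) by simp
      then have "(x'', h') \<in> G x \<longleftrightarrow> (x'', h') \<in> ?G x" using top_cell[OF off] sub[of x] by blast
      then show ?thesis using G.top[OF off *] by blast
    next
      case False
      then show ?thesis using G.top[OF off *] by simp
    qed
  next
    case (10 x i z y)
    have off: "off (A - {r}) h x" using 10 by (simp add: off_A)
    show ?case
    proof (cases "i = r")
      case True
      have "same_gap (A - {r}) h x (line r h)"
        using nbr_imp_same[of r "A - {r}" h x] 10 off_r True assms(2) by (simp add: insert_absorb)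
      then show ?thesis using 10(3) True by simp
    next
      case False
      then have "nbr (A - {r}) h x i" using 10(2) by (auto simp: nbr_def)
      then show ?thesis using 10(3) sub[of x] G.nbr_side[OF off] by blast
    qed
  next
    case (11 x x')
    then have "G x = G x'" by (intro G.gap_cong) (auto simp: off_A same_A)
    moreover have "same_gap (A - {r}) h x (line r h) \<longleftrightarrow> same_gap (A - {r}) h x' (line r h)"
      using 11 by (auto simp: same_gap_def)
    ultimately show ?case using 11 by (simp add: same_A)
  next
    case (12 x x' q)
    have off: "off (A - {r}) h x" "off (A - {r}) h x'" using 12 by (auto simp: off_A)
    have s: "same_gap (A - {r}) h x x'"
      using G.separated[OF off] 12 sub[of x] sub[of x'] by blast
    show ?case
    proof (cases "same_gap (A - {r}) h x (line r h)")
      case True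
      then have "same_gap (A - {r}) h x' (line r h)" using s by (auto simp: same_gap_def)
      with True 12 s show ?thesis by (auto simp: same_A)
    next
      case False then show ?thesis using s same_side off by (simp add: same_A)
    qed
  next
    case (13 y z)
    then obtain x where x: "off (A - {r}) h x" "(z, y) \<in> G x"
      using G.covers[of y z] by (auto simp: off_def)
    show ?case
    proof (cases "same_gap (A - {r}) h x (line r h)")
      case True
      have "sgn (z - line r y) = 1 \<or> sgn (z - line r y) = -1"
        using 13(3) assms(2) by (cases z "line r y" rule: linorder_cases) (auto simp: off_def)
      \<comment> \<open>The base point \<open>x\<close> may be on the wrong side of
        \<open>r\<close>; it is replaced by one in the same gap on the side of the point to be
        covered.\<close>
      then obtain x' where x': "same_gap (A - {r}) h x' (line r h)" "sgn (x' - line r h) = sgn (z - line r y)"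
        using off_point_near[OF _ off_r] assms(1) by (metis finite_Diff)
      have "off (A - {r}) h x'" using same_gap_off[OF same_gap_sym[OF x'(1)] off_r] .
      moreover have "G x' = G x"
        using G.gap_cong[OF x(1)] same_gap_trans[OF True same_gap_sym[OF x'(1)]] by metis
      moreover have "x' \<noteq> line r h" using x'(2) 13 assms(2) by (auto simp: off_def sgn_zero_iff)
      ultimately show ?thesis using x' x by (intro exI[of _ x']) (auto simp: off_A)
    next
      case False
      moreover have "x \<noteq> line r h" using False by auto
      ultimately show ?thesis using x by (intro exI[of _ x]) (auto simp: off_A)
    qed
  next
    case (14 z)
    then obtain x where x: "off (A - {r}) h x" "(z, h') \<in> G x"
      using G.covers_top[of z] by auto
    show ?case
    proof (cases "same_gap (A - {r}) h x (line r h)")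
      case True
      \<comment> \<open>The base point has to be on side \<open>\<sigma>\<close>, since the other
        half of the cell ends below the top.\<close>
      obtain x' where x': "same_gap (A - {r}) h x' (line r h)" "sgn (x' - line r h) = \<sigma>"
        using off_point_near[OF _ off_r \<sigma>] assms(1) by (metis finite_Diff)
      have o: "off (A - {r}) h x'" using same_gap_off[OF same_gap_sym[OF x'(1)] off_r] .
      moreover have "G x' = G x"
        using G.gap_cong[OF x(1)] same_gap_trans[OF True same_gap_sym[OF x'(1)]] by metis
      moreover have "x' \<noteq> line r h" using x'(2) \<sigma> by auto
      ultimately show ?thesis using x' x top_cell[OF o x'(2)]
        by (intro exI[of _ x'] conjI) (auto simp: off_A)
    next
      case False
      moreover have "x \<noteq> line r h" using False by auto
      ultimately show ?thesis using x by (intro exI[of _ x]) (auto simp: off_A)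
    qed
  qed
qed

text \<open>Induction on the set of lines. At the lowest meeting two lines coincide, and one of
  them, \<open>r\<close>, carries a segment that has already ended. The cells without
  \<open>r\<close> exist by induction, and \<open>r\<close> is then inserted up to that
  height.\<close>

lemma strip_cells_exist:
  assumes "finite A" "h \<le> h'"
    and "\<And>i j. i \<in> A \<Longrightarrow> j \<in> A \<Longrightarrow> i \<noteq> j \<Longrightarrow> line i h \<noteq> line j h"
    and "\<And>i j y. i \<in> A \<Longrightarrow> j \<in> A \<Longrightarrow> i \<noteq> j \<Longrightarrow> h \<le> y \<Longrightarrow> y \<le> b i \<Longrightarrow> y \<le> b j \<Longrightarrow> line i y \<noteq> line j y"
  shows "\<exists>B G. strip_cells al be b A h h' B G"
  using assms
proof (induction A rule: finite_psubset_induct)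
  case (psubset A)
  define W where "W = {y. h \<le> y \<and> y \<le> h' \<and> (\<exists>i\<in>A. \<exists>j\<in>A. i \<noteq> j \<and> line i y = line j y)}"
  show ?case
  proof (cases "W = {}")
    case True
    then have "line i y \<noteq> line j y" if "i \<in> A" "j \<in> A" "i \<noteq> j" "h \<le> y" "y \<le> h'" for i j y
      using that by (auto simp: W_def)
    then show ?thesis
      using strip_cells_no_meeting[OF psubset.hyps(1) psubset.prems(1), of b] by metis
  next
    case False
    \<comment> \<open>Lines that differ at height \<open>h\<close> meet in at most one height, so
      there are finitely many meetings and a lowest one.\<close>
    have "W \<subseteq> (\<lambda>(i, j). (al j - al i) / (be i - be j)) ` (A \<times> A)"
    proof
      fix y assume "y \<in> W"
      then obtain i j where ij: "i \<in> A" "j \<in> A" "i \<noteq> j" "line i y = line j y" by (auto simp: W_def)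
      then have "be i \<noteq> be j" using psubset.prems(2)[of i j] by (auto simp: line_def)
      then have "y = (al j - al i) / (be i - be j)" using ij(4) by (simp add: line_def field_simps)
      then show "y \<in> (\<lambda>(i, j). (al j - al i) / (be i - be j)) ` (A \<times> A)" using ij by force
    qed
    then have fin: "finite W" by (rule finite_subset) (use psubset.hyps in auto)
    define w where "w = Min W"
    have "w \<in> W" using fin False by (simp add: w_def)
    then obtain i j where ij: "i \<in> A" "j \<in> A" "i \<noteq> j" "line i w = line j w" "h \<le> w" "w \<le> h'"
      by (auto simp: W_def)
    have first: "line i y \<noteq> line j y" if "i \<in> A" "j \<in> A" "i \<noteq> j" "h \<le> y" "y < w" for i j y
      using Min_le[OF fin, of y] that ij(6) by (force simp: W_def w_def)
    \<comment> \<open>If both segments still reached height \<open>w\<close>, they would meet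
      there.\<close>
    have "b i < w \<or> b j < w" using psubset.prems(3)[of i j w] ij by force
    then obtain r j where r: "r \<in> A" "j \<in> A" "r \<noteq> j" "line r w = line j w" "b r < w"
      using ij by metis
    have "h \<noteq> w" using psubset.prems(2) r by metis
    then have "h < w" using ij by simp
    have "off (A - {r}) h (line r h)" using psubset.prems(2) r by (fastforce simp: off_def)
    moreover have "\<not> same_gap (A - {r}) h (line r h) (line j h)"
      using r psubset.prems(2)[of r j] by (force simp: same_gap_def sgn_zero_iff)
    \<comment> \<open>Several lines may pass through the meeting point, so \<open>j\<close> need not
      be adjacent to \<open>r\<close>; \<open>c\<close> is the neighbour of \<open>r\<close> towards
      \<open>j\<close>.\<close>
    ultimately obtain c where c: "nbr (A - {r}) h (line r h) c"
      "sgn (line r h - line c h) \<noteq> sgn (line j h - line c h)"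
      using nbr_separates psubset.hyps by (metis finite_Diff)
    have cA: "c \<in> A" "c \<noteq> r" using c by (auto simp: nbr_def)
    \<comment> \<open>Otherwise \<open>c\<close> would still separate \<open>r\<close> from
      \<open>j\<close> at height \<open>w\<close>, where these two coincide.\<close>
    have "line r w = line c w"
    proof (rule ccontr)
      assume *: "line r w \<noteq> line c w"
      then have "c \<noteq> j" using r by auto
      have "sgn (line r h - line c h) = sgn (line r w - line c w)"
        by (rule order_preserved) (use first * r cA \<open>h < w\<close> in \<open>force simp: le_less\<close>)+
      moreover have "sgn (line j h - line c h) = sgn (line j w - line c w)"
        by (rule order_preserved) (use first * r cA \<open>h < w\<close> \<open>c \<noteq> j\<close> in \<open>force simp: le_less\<close>)+
      ultimately show False using c(2) r by simp
    qed
    moreover obtain B G where "strip_cells al be b (A - {r}) h h' B G"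
      using psubset.IH[of "A - {r}"] psubset.prems r by auto
    ultimately have "strip_cells al be b A h h' B
      (\<lambda>x. if same_gap (A - {r}) h x (line r h)
           then G x \<inter> {(z, y). sgn (z - line r y) = sgn (x - line r h)} else G x)"
      using first r(1) c(1) \<open>h < w\<close> ij(6) r(5) psubset.prems(2) psubset.hyps(1)
      by (intro strip_cells_insert[of A r w c]) auto
    then show ?thesis by blast
  qed
qed

end

section \<open>The sweep: starting a segment and advancing to a greater height\<close>

text \<open>State of the sweep at height \<open>h\<close>: the segments in \<open>J\<close>, over the heights from \<open>a\<close> to \<open>b\<close>, have
  started, the lines in \<open>A\<close> still bound cells, and \<open>KK\<close> contains both the cells that end below
  \<open>h\<close> and those that reach \<open>h\<close>.\<close>
locale sweep_cells = lines al be for al be :: "'i \<Rightarrow> real" +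
  fixes a b :: "'i \<Rightarrow> real" and J :: "'i set" and h :: real
    and A :: "'i set" and KK :: "(real \<times> real) set set"
  assumes active: "A \<subseteq> J" "{j\<in>J. h \<le> b j} \<subseteq> A"
    and distinct: "i \<in> A \<Longrightarrow> j \<in> A \<Longrightarrow> i \<noteq> j \<Longrightarrow> line i h \<noteq> line j h"
    and finite_cells: "finite KK" and card_cells: "card KK \<le> card J + 1"
    and convex_cell: "K \<in> KK \<Longrightarrow> convex K"
    and below: "K \<in> KK \<Longrightarrow> (z, y) \<in> K \<Longrightarrow> y \<le> h"
    and avoids: "K \<in> KK \<Longrightarrow> j \<in> J \<Longrightarrow> a j \<le> y \<Longrightarrow> y \<le> b j \<Longrightarrow> (line j y, y) \<notin> K"
    and top_off: "K \<in> KK \<Longrightarrow> (x, h) \<in> K \<Longrightarrow> off A h x"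
    and top_gap: "K \<in> KK \<Longrightarrow> (x, h) \<in> K \<Longrightarrow> (x', h) \<in> K \<longleftrightarrow> same_gap A h x x'"
    and covers_top: "off A h x \<Longrightarrow> \<exists>K\<in>KK. (x, h) \<in> K"
    and top_unique: "K \<in> KK \<Longrightarrow> K' \<in> KK \<Longrightarrow> (x, h) \<in> K \<Longrightarrow> (x, h) \<in> K' \<Longrightarrow> K = K'"
    and covers: "y \<le> h \<Longrightarrow> off J y z \<Longrightarrow> \<exists>K\<in>KK. (z, y) \<in> K"
    and nbr_side: "K \<in> KK \<Longrightarrow> (x, h) \<in> K \<Longrightarrow> (z, y) \<in> K \<Longrightarrow> nbr A h x i \<Longrightarrow>
      (z - line i y) * (x - line i h) \<ge> 0"

context lines begin

lemma sweep_cells_empty: "sweep_cells al be a b {} h {} {{(z, y). y \<le> h}}"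
proof (unfold_locales, goal_cases)
  case (6 K)
  have "{(z::real, y). y \<le> h} = {p. (0, 1) \<bullet> p \<le> h}" by auto
  then show ?case using 6 by (simp add: convex_halfspace_le)
qed (auto simp: off_def same_gap_def nbr_def)

text \<open>The lower endpoint of \<open>s\<close> lies in a single cell \<open>K0\<close>, which is
  replaced by its two open sides of the line \<open>s\<close>, so the count grows by at most one.
  The points of \<open>K0\<close> on the line are lost, but \<open>covers\<close> asks only for
  points off all lines.\<close>

lemma sweep_cells_insert:
  assumes "sweep_cells al be a b J h A KK"
    and "finite J" "s \<notin> J" "a s = h" "off J h (line s h)"
  shows "\<exists>KK'. sweep_cells al be a b (insert s J) h (insert s A) KK'"
proof -
  interpret V: sweep_cells al be a b J h A KK by (rule assms)
  have off_s: "off A h (line s h)" using assms(5) V.active by (auto simp: off_def)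
  have off_A: "off (insert s A) h x \<longleftrightarrow> off A h x \<and> x \<noteq> line s h" for x
    by (auto simp: off_def)
  have same_A: "same_gap (insert s A) h x x' \<longleftrightarrow> same_gap A h x x' \<and> sgn (x - line s h) = sgn (x' - line s h)" for x x'
    by (auto simp: same_gap_def)
  obtain K0 where K0: "K0 \<in> KK" "(line s h, h) \<in> K0" using V.covers_top off_s by blast
  define part where "part \<sigma> = K0 \<inter> {(z, y). sgn (z - line s y) = \<sigma>}" for \<sigma>
  define KK' where "KK' = {part 1, part (-1)} \<union> (KK - {K0})"
  have cell: "\<exists>K0\<in>KK. K \<subseteq> K0" if "K \<in> KK'" for K
    using that K0 by (auto simp: KK'_def part_def)
  have cases: thesis if "K \<in> KK'" "\<And>\<sigma>. K = part \<sigma> \<Longrightarrow> \<sigma> = 1 \<or> \<sigma> = -1 \<Longrightarrow> thesis"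
    "K \<in> KK \<Longrightarrow> K \<noteq> K0 \<Longrightarrow> (line s h, h) \<notin> K \<Longrightarrow> thesis" for K thesis
    using that(1)[unfolded KK'_def] that(2)[of 1] that(2)[of "-1"] that(3)
      V.top_unique[of K K0 "line s h"] K0 by blast
  have not_same: "\<not> same_gap A h x (line s h)" if "K \<in> KK" "(line s h, h) \<notin> K" "(x, h) \<in> K" for K x
    using V.top_gap[OF that(1,3)] that(2) by blast
  have "sweep_cells al be a b (insert s J) h (insert s A) KK'"
  proof (unfold_locales, goal_cases)
    case 1 then show ?case using V.active by auto
  next
    case 2 then show ?case using V.active by auto
  next
    case (3 i j) then show ?case using V.distinct[of i j] off_s by (force simp: off_def)
  next
    case 4 then show ?case using V.finite_cells by (simp add: KK'_def)
  next
    case 5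
    have "card KK' \<le> card {part 1, part (-1)} + card (KK - {K0})"
      unfolding KK'_def by (rule card_Un_le)
    also have "\<dots> \<le> 2 + (card KK - 1)"
      using K0 V.finite_cells by (intro add_mono) (auto simp: card_insert_if)
    also have "\<dots> \<le> card (insert s J) + 1"
      using V.card_cells K0 V.finite_cells assms(2,3) card_gt_0_iff[of KK] by auto
    finally show ?case .
  next
    case (6 K)
    show ?case using 6
    proof (rule cases)
      show "convex K" if "K = part \<sigma>" for \<sigma>
        unfolding that part_def by (intro convex_Int convex_side V.convex_cell K0)
    qed (rule V.convex_cell)
  next
    case (7 K z y) then show ?case using cell[of K] V.below by blast
  next
    case (8 K j y)
    show ?case
    proof (cases "j = s")
      case True
      show ?thesis using 8(1)
      proof (rule cases)
        \<comment> \<open>A cell other than \<open>K0\<close> ends at height \<open>h = a s\<close>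
          at the latest, so the lower endpoint is the only point of the new segment that it could
          contain.\<close>
        assume "K \<in> KK" "(line s h, h) \<notin> K"
        then show ?thesis using V.below[of K "line j y" y] 8 True assms(4) by force
      qed (auto simp: part_def True)
    next
      case False then show ?thesis using 8 cell[of K] V.avoids by blast
    qed
  next
    case (9 K x)
    have "off A h x" using 9 cell[of K] V.top_off by blast
    moreover have "x \<noteq> line s h" using 9(1) by (rule cases) (use 9 in \<open>auto simp: part_def\<close>)
    ultimately show ?case by (simp add: off_A)
  next
    case (10 K x x')
    show ?case using 10(1)
    proof (rule cases)
      fix \<sigma> assume "K = part \<sigma>"
      then show ?thesis using 10(2) V.top_gap[OF K0(1), of x x'] by (auto simp: part_def same_A)
    next
      assume K: "K \<in> KK" "K \<noteq> K0" "(line s h, h) \<notin> K"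
      then show ?thesis
        using V.top_gap[OF K(1) 10(2), of x'] not_same[OF K(1,3) 10(2)]
          same_side[OF V.top_off[OF K(1) 10(2)] off_s] by (auto simp: same_A)
    qed
  next
    case (11 x)
    then obtain K where K: "K \<in> KK" "(x, h) \<in> K" using V.covers_top off_A by blast
    show ?case
    proof (cases "K = K0")
      case True
      then have "(x, h) \<in> part (sgn (x - line s h))" "sgn (x - line s h) \<in> {1, -1}"
        using K 11 by (auto simp: part_def off_A sgn_if)
      then show ?thesis by (auto simp: KK'_def)
    qed (use K in \<open>auto simp: KK'_def\<close>)
  next
    case (12 K K' x)
    show ?case using 12(1)
    proof (rule cases)
      fix \<sigma> assume K: "K = part \<sigma>"
      show ?thesis using 12(2)
      proof (rule cases)
        fix \<sigma>' assume "K' = part \<sigma>'"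
        then show ?thesis using 12 K by (auto simp: part_def)
      next
        assume "K' \<in> KK" "K' \<noteq> K0"
        then show ?thesis using 12(3,4) K V.top_unique[of K' K0 x] K0(1) unfolding part_def by blast
      qed
    next
      assume K: "K \<in> KK" "K \<noteq> K0"
      show ?thesis using 12(2)
      proof (rule cases)
        fix \<sigma>' assume "K' = part \<sigma>'"
        then show ?thesis using 12(3,4) K V.top_unique[of K K0 x] K0(1) unfolding part_def by blast
      next
        assume "K' \<in> KK"
        then show ?thesis using 12(3,4) K(1) V.top_unique by blast
      qed
    qed
  next
    case (13 y z)
    then obtain K where K: "K \<in> KK" "(z, y) \<in> K" using V.covers[of y z] by (auto simp: off_def)
    show ?case
    proof (cases "K = K0")
      case True
      then have "(z, y) \<in> part (sgn (z - line s y))" "sgn (z - line s y) \<in> {1, -1}"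
        using K 13 by (auto simp: part_def off_def sgn_if)
      then show ?thesis unfolding KK'_def by fastforce
    next
      case False
      then show ?thesis using K unfolding KK'_def by blast
    qed
  next
    case (14 K x z y i)
    obtain K1 where K1: "K1 \<in> KK" "K \<subseteq> K1" using cell[OF 14(1)] by blast
    show ?case
    proof (cases "i = s")
      case True
      show ?thesis using 14(1)
      proof (rule cases)
        fix \<sigma> :: real assume "K = part \<sigma>"
        then have "sgn (z - line i y) = sgn (x - line i h)" using 14(2,3) True by (auto simp: part_def)
        then show ?thesis by (auto simp: sgn_if zero_le_mult_iff split: if_splits)
      next
        assume K: "K \<in> KK" "K \<noteq> K0" "(line s h, h) \<notin> K"
        \<comment> \<open>With \<open>s\<close> a neighbour of \<open>x\<close>, the lower endpoint
          would lie in the gap of \<open>x\<close> and hence in \<open>K\<close>: this case is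
          contradictory.\<close>
        have "off (insert s A) h x" using V.top_off[OF K(1) 14(2)] K(3) 14(2) by (auto simp: off_A)
        then show ?thesis using nbr_imp_same[of s A h x] 14(4) True off_s not_same[OF K(1,3) 14(2)] by blast
      qed
    next
      case False
      then have "nbr A h x i" using 14(4) by (auto simp: nbr_def)
      then show ?thesis using V.nbr_side[OF K1(1)] K1(2) 14(2,3) by blast
    qed
  qed
  then show ?thesis by blast
qed

text \<open>If a point of a convex set lay across a line bounding its top edge, the segments from
  that point to the part of the top edge near the line would meet the line arbitrarily close
  to the top.\<close>
lemma convex_nbr_side:
  assumes "convex C" "h < h'" "(x, h') \<in> C" "(z, y) \<in> C" "y \<le> h'" "off B h' x" "nbr B h' x i"
    and gap: "\<And>x'. same_gap B h' x x' \<Longrightarrow> (x', h') \<in> C"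
    and gap': "\<And>x'. (x', h') \<in> C \<Longrightarrow> same_gap B h' x x'"
    and avoids_line: "\<And>y. h \<le> y \<Longrightarrow> y \<le> h' \<Longrightarrow> (line i y, y) \<notin> C"
  shows "(z - line i y) * (x - line i h') \<ge> 0"
proof (rule ccontr)
  define d where "d = z - line i y"
  define e where "e = x - line i h'"
  assume "\<not> ?thesis"
  then have de: "d * e < 0" by (simp add: d_def e_def)
  then have [simp]: "d \<noteq> 0" "e \<noteq> 0" by auto
  have iB: "i \<in> B" using assms(7) by (simp add: nbr_def)
  \<comment> \<open>At height \<open>h'\<close> itself, both points would lie in the same gap of
    \<open>B\<close> and thus on the same side of \<open>i\<close>.\<close>
  have "y < h'"
  proof (rule ccontr)
    assume "\<not> y < h'"
    then have "y = h'" using assms by simp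
    then have "same_gap B h' x z" using gap' assms(4) by blast
    then have "sgn d = sgn e" using iB \<open>y = h'\<close> unfolding same_gap_def d_def e_def by metis
    then show False using de by (auto simp: sgn_if mult_less_0_iff split: if_splits)
  qed
  \<comment> \<open>The weight of \<open>(z, y)\<close> in a combination with a top point: small
    enough that this top point is no farther from the line than \<open>x\<close> and that the
    combination stays at height \<open>h\<close> or above. The bound \<open>1/2\<close> gives
    \<open>\<epsilon> / (1 - \<epsilon>) \<le> 2 * \<epsilon>\<close>.\<close>
  define \<epsilon> where "\<epsilon> = min (1/2) (min (\<bar>e\<bar> / (2 * \<bar>d\<bar>)) ((h' - h) / (h' - y)))"
  have \<epsilon>: "0 < \<epsilon>" "\<epsilon> \<le> 1/2" "\<epsilon> \<le> \<bar>e\<bar> / (2 * \<bar>d\<bar>)" "\<epsilon> \<le> (h' - h) / (h' - y)"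
    using \<open>y < h'\<close> assms(2) unfolding \<epsilon>_def
    by (simp, metis min.cobounded1, simp_all)
  have \<epsilon>d: "\<epsilon> * (2 * \<bar>d\<bar>) \<le> \<bar>e\<bar>" using \<epsilon>(3) by (simp add: pos_le_divide_eq)
  have \<epsilon>h: "\<epsilon> * (h' - y) \<le> h' - h" using \<epsilon>(4) \<open>y < h'\<close> by (simp add: pos_le_divide_eq)
  \<comment> \<open>The solution of \<open>(1 - \<epsilon>) * \<delta> + \<epsilon> * d = 0\<close>,
    which puts the combination exactly on line \<open>i\<close>.\<close>
  define \<delta> where "\<delta> = - (\<epsilon> / (1 - \<epsilon>)) * d"
  have "\<epsilon> / (1 - \<epsilon>) \<le> 2 * \<epsilon>" using \<epsilon> by (simp add: divide_simps)
  then have "\<bar>\<delta>\<bar> \<le> 2 * \<epsilon> * \<bar>d\<bar>" using \<epsilon>(1,2)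
    unfolding \<delta>_def abs_mult by (intro mult_right_mono) auto
  then have \<delta>: "\<bar>\<delta>\<bar> \<le> \<bar>e\<bar>" using \<epsilon>d by simp
  have \<delta>_sgn: "sgn \<delta> = sgn e" using de \<epsilon>
    by (auto simp: \<delta>_def sgn_mult mult_less_0_iff)
  define t where "t = line i h' + \<delta>"
  have "same_gap B h' x t" unfolding same_gap_def
  proof
    fix j assume j: "j \<in> B"
    then have "x \<noteq> line j h'" using assms(6) by (simp add: off_def)
    moreover have "sgn (line j h' - x) = sgn (line i h' - x) \<longrightarrow> \<bar>line i h' - x\<bar> \<le> \<bar>line j h' - x\<bar>"
      using assms(7) j by (simp add: nbr_def)
    ultimately show "sgn (x - line j h') = sgn (t - line j h')"
      using \<delta> \<delta>_sgn \<open>e \<noteq> 0\<close> unfolding t_def e_def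
      by (auto simp: sgn_if abs_if split: if_splits)
  qed
  then have tC: "(t, h') \<in> C" by (rule gap)
  define v where "v = (1 - \<epsilon>) * h' + \<epsilon> * y"
  have v: "h \<le> v" "v \<le> h'"
    using \<epsilon>h \<epsilon> \<open>y < h'\<close> by (auto simp: v_def algebra_simps)
  have "(1 - \<epsilon>) *\<^sub>R (t, h') + \<epsilon> *\<^sub>R (z, y) \<in> C"
    using assms(1,4) tC \<epsilon> by (intro convexD) auto
  also have "(1 - \<epsilon>) *\<^sub>R (t, h') + \<epsilon> *\<^sub>R (z, y) = (line i v, v)"
  proof -
    have "(1 - \<epsilon>) * \<delta> = - \<epsilon> * d" using \<epsilon> by (simp add: \<delta>_def)
    then have "(1 - \<epsilon>) * t + \<epsilon> * z = line i v"
      unfolding v_def line_affine t_def d_def by (simp add: algebra_simps)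
    then show ?thesis by (simp add: v_def)
  qed
  finally show False using avoids_line v by blast
qed

text \<open>Each cell that reaches height \<open>h\<close> is prolonged by the strip cell above its
  gap, and the other cells stay as they are, so no cell is created.\<close>

lemma sweep_cells_advance:
  assumes "sweep_cells al be a b J h A KK"
    and "finite J" "h < h'" "\<And>j. j \<in> J \<Longrightarrow> a j \<le> h"
    and "\<And>i j y. i \<in> J \<Longrightarrow> j \<in> J \<Longrightarrow> i \<noteq> j \<Longrightarrow> a i \<le> y \<Longrightarrow> y \<le> b i \<Longrightarrow> a j \<le> y \<Longrightarrow> y \<le> b j \<Longrightarrow>
      line i y \<noteq> line j y"
  shows "\<exists>B KK'. sweep_cells al be a b J h' B KK'"
proof -
  interpret V: sweep_cells al be a b J h A KK by (rule assms)
  have "finite A" using V.active assms(2) finite_subset by blast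
  moreover have "line i y \<noteq> line j y" if "i \<in> A" "j \<in> A" "i \<noteq> j" "h \<le> y" "y \<le> b i" "y \<le> b j" for i j y
  proof -
    have "i \<in> J" "j \<in> J" using that V.active by auto
    then show ?thesis using assms(4)[of i] assms(4)[of j] assms(5)[of i j y] that by force
  qed
  ultimately obtain B G where G: "strip_cells al be b A h h' B G"
    using strip_cells_exist[of A h h' b] assms(3) V.distinct by auto
  interpret G: strip_cells al be b A h h' B G by (rule G)
  \<comment> \<open>The points of \<open>K\<close> at height \<open>h\<close> form a single gap, so
    the union adds at most one strip cell, without a choice of a base point.\<close>
  define ext where "ext K = K \<union> (\<Union>x\<in>{x. (x, h) \<in> K}. G x)" for K
  have ext_live: "ext K = K \<union> G x" if "K \<in> KK" "(x, h) \<in> K" for K x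
  proof -
    have "G x' = G x" if "(x', h) \<in> K" for x'
      using V.top_gap \<open>K \<in> KK\<close> \<open>(x, h) \<in> K\<close> that V.top_off G.gap_cong by metis
    then show ?thesis using that unfolding ext_def by blast
  qed
  have ext_dead: "ext K = K" if "\<nexists>x. (x, h) \<in> K" for K
    using that by (auto simp: ext_def)
  have top_ext: "\<exists>x. off A h x \<and> (x, h) \<in> K \<and> (z, h') \<in> G x \<and> ext K = K \<union> G x"
    if K: "K \<in> KK" and z: "(z, h') \<in> ext K" for K z
  proof -
    have "(z, h') \<notin> K" using V.below[OF K, of z h'] assms(3) by auto
    then obtain x where "(x, h) \<in> K" "(z, h') \<in> G x" using z unfolding ext_def by blast
    then show ?thesis using K ext_live V.top_off by blast
  qed
  have top_G: "(z, h') \<notin> K" if "K \<in> KK" for K z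
    using V.below[OF that, of z h'] assms(3) by auto
  have off_top: "off B h' z" if "off A h x" "(z, h') \<in> G x" for x z
    unfolding off_def using G.avoids_survivor[OF that(1), of _ h'] that(2) assms(3) by auto
  have convex_ext: "convex (ext K)" if K: "K \<in> KK" for K
  proof (cases "\<exists>x. (x, h) \<in> K")
    case True
    then obtain x where x: "(x, h) \<in> K" by blast
    then have off: "off A h x" using V.top_off K by blast
    have "convex (K \<union> G x)"
    proof (rule convex_glue[of _ _ h])
      fix z y z' y' t
      assume zy: "(z, y) \<in> K" "(z', y') \<in> G x" and t: "0 < t" "t < (1::real)" "(1 - t) * y + t * y' = h"
      \<comment> \<open>A segment from \<open>K\<close> to \<open>G x\<close> cannot leave the gap
        at height \<open>h\<close>: with respect to each neighbour of \<open>x\<close>, its lower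
        end is weakly and its upper end strictly on the side of \<open>x\<close>.\<close>
      have "same_gap A h x ((1 - t) * z + t * z')"
      proof (rule ccontr)
        assume "\<not> ?thesis"
        then obtain i where i: "nbr A h x i" "sgn (x - line i h) \<noteq> sgn ((1 - t) * z + t * z' - line i h)"
          using nbr_separates[OF \<open>finite A\<close> off] by blast
        define d where "d = (1 - t) * (z - line i y)"
        define d' where "d' = t * (z' - line i y')"
        have "(1 - t) * z + t * z' - line i h = d + d'"
          unfolding t(3)[symmetric] line_affine d_def d'_def by (simp add: algebra_simps)
        moreover have "d * (x - line i h) \<ge> 0"
          using V.nbr_side[OF K x zy(1) i(1)] t by (simp add: d_def mult.assoc)
        moreover have "sgn d' = sgn (x - line i h)"
          using G.nbr_side[OF off i(1) zy(2)] t by (simp add: d'_def sgn_mult)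
        moreover have "x \<noteq> line i h" using off i(1) by (simp add: off_def nbr_def)
        ultimately show False using i(2)
          by (auto simp: sgn_if zero_le_mult_iff split: if_splits)
      qed
      then show "((1 - t) * z + t * z', h) \<in> K" using V.top_gap K x by blast
    qed (use V.convex_cell K G.convex_cell off V.below G.in_strip G.bottom V.top_gap x in blast)+
    then show ?thesis using ext_live K x by simp
  qed (use ext_dead V.convex_cell K in auto)
  have "sweep_cells al be a b J h' B (ext ` KK)"
  proof (unfold_locales, goal_cases)
    case 1 show ?case using V.active G.survivors by blast
  next
    case 2 show ?case using V.active G.survivors assms(3) by force
  next
    case (3 i j) then show ?case by (rule G.distinct_top)
  next
    case 4 show ?case using V.finite_cells by simp
  next
    case 5 show ?case using card_image_le[OF V.finite_cells] V.card_cells order_trans by blast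
  next
    case (6 K) then show ?case using convex_ext by blast
  next
    case (7 K z y) then show ?case
      using V.below V.top_off G.in_strip assms(3) by (fastforce simp: ext_def)
  next
    case (8 K j y)
    then obtain K' where K': "K' \<in> KK" "K = ext K'" by blast
    have "(line j y, y) \<notin> G x" if "(x, h) \<in> K'" for x
    proof
      assume *: "(line j y, y) \<in> G x"
      have off: "off A h x" using V.top_off K' that by blast
      have y: "h \<le> y" "y \<le> h'" using G.in_strip[OF off *] by auto
      \<comment> \<open>A segment with a point at height \<open>y \<ge> h\<close> has
        \<open>h \<le> b j\<close>, so it is still active.\<close>
      then have "j \<in> A" using V.active 8 by auto
      then show False using G.avoids[OF off] y 8 * by blast
    qed
    then show ?case using V.avoids[OF K'(1)] 8 K' by (auto simp: ext_def)
  next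
    case (9 K z) then show ?case using top_ext off_top by blast
  next
    case (10 K z z')
    then obtain K' where K': "K' \<in> KK" "K = ext K'" by blast
    then obtain x where "off A h x" "(z, h') \<in> G x" "K = K' \<union> G x" using top_ext[of K' z] 10 by blast
    then show ?case using G.top[of x z z'] top_G[OF K'(1)] by blast
  next
    case (11 z)
    then obtain x where x: "off A h x" "(z, h') \<in> G x" using G.covers_top by blast
    then obtain K where "K \<in> KK" "(x, h) \<in> K" using V.covers_top by blast
    then show ?case using x by (auto simp: ext_def)
  next
    case (12 K K' z)
    then obtain L L' where L: "L \<in> KK" "K = ext L" "L' \<in> KK" "K' = ext L'" by blast
    obtain x where x: "off A h x" "(x, h) \<in> L" "(z, h') \<in> G x" using top_ext[OF L(1)] 12(3) L(2) by blast
    obtain x' where x': "off A h x'" "(x', h) \<in> L'" "(z, h') \<in> G x'" using top_ext[OF L(3)] 12(4) L(4) by blast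
    have "same_gap A h x x'" using G.separated x x' by blast
    then have "(x', h) \<in> L" using V.top_gap L(1) x(2) by blast
    then have "L = L'" using V.top_unique L(1,3) x'(2) by blast
    then show ?case using L by simp
  next
    case (13 y z)
    show ?case
    proof (cases "y \<le> h")
      case True
      then show ?thesis using V.covers[of y z] 13(2) unfolding ext_def by blast
    next
      case False
      have "off A y z" using 13 V.active by (auto simp: off_def)
      then obtain x where x: "off A h x" "(z, y) \<in> G x"
        using G.covers[of y z] False 13(1) by auto
      obtain K where K: "K \<in> KK" "(x, h) \<in> K" using V.covers_top x(1) by blast
      then have "(z, y) \<in> ext K" using ext_live[OF K] x(2) by simp
      then show ?thesis using K(1) by blast
    qed
  next
    case (14 K x' z y i)
    then obtain K' where K': "K' \<in> KK" "K = ext K'" by blast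
    then obtain x where x: "off A h x" "(x, h) \<in> K'" "(x', h') \<in> G x" "K = K' \<union> G x"
      using top_ext[OF K'(1), of x'] 14(2) by blast
    have y: "y \<le> h'"
      using 14(3) V.below[OF K'(1), of z y] G.in_strip[OF x(1), of z y] assms(3) unfolding x(4) by auto
    have iB: "i \<in> B" using 14(4) by (simp add: nbr_def)
    show ?case
    proof (rule convex_nbr_side[of K h h' x' z y B i])
      show "convex K" using convex_ext K' by simp
      show "off B h' x'" using off_top x by blast
      show "(w, h') \<in> K" if "same_gap B h' x' w" for w using G.top[OF x(1,3)] that x(4) by blast
      show "same_gap B h' x' w" if "(w, h') \<in> K" for w
        using G.top[OF x(1,3)] that top_G[OF K'(1)] x(4) by blast
      show "(line i v, v) \<notin> K" if v: "h \<le> v" "v \<le> h'" for v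
      proof -
        have *: "(line i v, v) \<notin> G x" using G.avoids_survivor[OF x(1) iB v] .
        \<comment> \<open>At heights from \<open>h\<close> on, \<open>K'\<close> has points only at
          height \<open>h\<close>, where it agrees with \<open>G x\<close>.\<close>
        moreover have "(line i v, v) \<notin> K'"
        proof
          assume **: "(line i v, v) \<in> K'"
          then have "v = h" using V.below[OF K'(1) **] v(1) by simp
          then show False using * ** V.top_gap[OF K'(1) x(2)] G.bottom[OF x(1)] by blast
        qed
        ultimately show ?thesis using x(4) by blast
      qed
    qed (fact 14(2-4) y assms(3))+
  qed
  then show ?thesis by blast
qed

text \<open>Induction on the set of segments. For the segment \<open>s\<close> that starts highest,
  the cells of the others are built up to height \<open>a s\<close>, one is cut there, and all are
  advanced to \<open>h\<close>.\<close>

lemma sweep_cells_exist: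
  assumes "finite J" "\<And>j. j \<in> J \<Longrightarrow> a j < h" "inj_on a J"
    and "\<And>i j y. i \<in> J \<Longrightarrow> j \<in> J \<Longrightarrow> i \<noteq> j \<Longrightarrow> a i \<le> y \<Longrightarrow> y \<le> b i \<Longrightarrow> a j \<le> y \<Longrightarrow> y \<le> b j \<Longrightarrow>
      line i y \<noteq> line j y"
    and "\<And>i j. i \<in> J \<Longrightarrow> j \<in> J \<Longrightarrow> i \<noteq> j \<Longrightarrow> line i (a i) \<noteq> line j (a i)"
  shows "\<exists>A KK. sweep_cells al be a b J h A KK"
  using assms
proof (induction J arbitrary: h rule: finite_psubset_induct)
  case (psubset J)
  show ?case
  proof (cases "J = {}")
    case True then show ?thesis using sweep_cells_empty by blast
  next
    case False
    then have "Max (a ` J) \<in> a ` J" using psubset.hyps(1) by simp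
    then obtain s where s: "s \<in> J" "a s = Max (a ` J)" by force
    have s_max: "a j \<le> a s" if "j \<in> J" for j
      using s(2) psubset.hyps(1) that by simp
    \<comment> \<open>Injectivity of \<open>a\<close> gives the strict inequality that the induction
      hypothesis at height \<open>a s\<close> demands.\<close>
    have "a j < a s" if "j \<in> J - {s}" for j
      using s_max[of j] s(1) that psubset.prems(2) inj_onD[of a J j s] by force
    then obtain A KK where "sweep_cells al be a b (J - {s}) (a s) A KK"
      using psubset.IH[of "J - {s}" "a s"] s psubset.prems
      by (auto intro: inj_on_subset)
    moreover have "off (J - {s}) (a s) (line s (a s))"
      unfolding off_def using psubset.prems(4) s(1) by blast
    ultimately obtain KK' where "sweep_cells al be a b (insert s (J - {s})) (a s) (insert s A) KK'"
      using sweep_cells_insert[of a b "J - {s}" "a s" A KK s] psubset.hyps(1) by blast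
    then have "sweep_cells al be a b J (a s) (insert s A) KK'"
      using s(1) by (simp add: insert_absorb)
    then show ?thesis
      by (rule sweep_cells_advance[OF _ psubset.hyps(1) psubset.prems(1)[OF s(1)] s_max psubset.prems(3)])
  qed
qed

end

section \<open>From a labeled point set to sweep coordinates and back\<close>

lemma generic_shear:
  fixes p :: "'i \<Rightarrow> real ^ 2"
  assumes "finite I" "inj_on p I"
  obtains t where "inj_on (\<lambda>i. p i $ 2 + t * p i $ 1) I"
proof -
  \<comment> \<open>The slopes at which two sheared heights can agree. A pair with equal first
    coordinates divides by zero and only contributes the value \<open>0\<close>.\<close>
  define bad where "bad = (\<lambda>(i, j). - (p i $ 2 - p j $ 2) / (p i $ 1 - p j $ 1)) ` (I \<times> I)"
  have "finite bad" using assms(1) by (simp add: bad_def)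
  then obtain t where t: "t \<notin> bad" using ex_new_if_finite[OF infinite_UNIV_char_0] by metis
  have "inj_on (\<lambda>i. p i $ 2 + t * p i $ 1) I"
  proof (rule inj_onI, rule ccontr)
    fix i j assume ij: "i \<in> I" "j \<in> I" "p i $ 2 + t * p i $ 1 = p j $ 2 + t * p j $ 1" "i \<noteq> j"
    show False
    proof (cases "p i $ 1 = p j $ 1")
      case True
      then have "p i = p j" using ij(3) by (simp add: vec_eq_iff forall_2)
      then show False using ij assms(2) by (simp add: inj_on_def)
    next
      case False
      then have "t = - (p i $ 2 - p j $ 2) / (p i $ 1 - p j $ 1)" using ij(3) by (simp add: field_simps)
      then have "t \<in> bad" using ij unfolding bad_def by (force intro!: image_eqI[of _ _ "(i, j)"])
      then show False using t by blast
    qed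
  qed
  then show thesis by (rule that)
qed

text \<open>A shear makes all heights distinct, so that no edge is horizontal. The sweep runs to a
  height above all points, and its cells are pulled back along the shear.\<close>

lemma convex_cells_exist:
  fixes p :: "nat \<Rightarrow> real ^ 2"
  assumes M: "matching n M" and inj: "inj_on p {1..n}" and gen: "general_position (p ` {1..n})"
    and cf: "crossing_free p M"
  obtains KK where "finite KK" "card KK \<le> card M + 1" "\<And>K. K \<in> KK \<Longrightarrow> convex K"
    "\<And>K u v. K \<in> KK \<Longrightarrow> {u, v} \<in> M \<Longrightarrow> closed_segment (p u) (p v) \<inter> K = {}"
    "\<And>q. q \<in> {1..n} - \<Union>M \<Longrightarrow> \<exists>K\<in>KK. p q \<in> K"
proof -
  have "M \<subseteq> Pow {1..n}" using M by (auto simp: matching_def)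
  then have fin: "finite M" by (rule finite_subset) simp
  obtain t where t: "inj_on (\<lambda>i. p i $ 2 + t * p i $ 1) {1..n}"
    using generic_shear[OF _ inj] by auto
  define X where "X i = p i $ 1" for i
  define Y where "Y i = p i $ 2 + t * p i $ 1" for i
  have Y_inj: "Y i \<noteq> Y j" if "i \<in> {1..n}" "j \<in> {1..n}" "i \<noteq> j" for i j
    using t that unfolding Y_def inj_on_def by blast
  have "\<exists>u v. e = {u, v} \<and> Y u < Y v" if "e \<in> M" for e
  proof -
    have e: "e \<subseteq> {1..n}" "card e = 2" using M that by (auto simp: matching_def)
    then obtain u v where uv: "e = {u, v}" "u \<noteq> v" by (auto simp: card_2_iff)
    then have "Y u \<noteq> Y v" using Y_inj e by auto
    then show ?thesis using uv by (metis insert_commute linorder_neqE_linordered_idom)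
  qed
  then obtain lo hi where ends: "\<And>e. e \<in> M \<Longrightarrow> e = {lo e, hi e}" "\<And>e. e \<in> M \<Longrightarrow> Y (lo e) < Y (hi e)"
    by metis
  have mem_ends: "i \<in> e \<longleftrightarrow> i = lo e \<or> i = hi e" if "e \<in> M" for e i
    using ends(1)[OF that] by blast
  have ends_n: "lo e \<in> {1..n}" "hi e \<in> {1..n}" if "e \<in> M" for e
    using mem_ends[OF that] M that unfolding matching_def by blast+
  have disj: "e \<inter> e' = {}" if "e \<in> M" "e' \<in> M" "e \<noteq> e'" for e e'
    using M that by (auto simp: matching_def pairwise_def disjnt_def)
  \<comment> \<open>Slope and offset of the line through both endpoints, with the first coordinate
    as a function of the height.\<close>
  define be where "be e = (X (hi e) - X (lo e)) / (Y (hi e) - Y (lo e))" for e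
  define al where "al e = X (lo e) - be e * Y (lo e)" for e
  define a where "a e = Y (lo e)" for e
  define b where "b e = Y (hi e)" for e
  interpret L: lines al be .
  define \<phi> :: "real ^ 2 \<Rightarrow> real \<times> real" where "\<phi> x = (x $ 1, x $ 2 + t * x $ 1)" for x
  have lin: "linear \<phi>" by (rule linearI) (auto simp: \<phi>_def algebra_simps)
  have \<phi>_inj: "x = y" if "\<phi> x = \<phi> y" for x y
    using that by (auto simp: \<phi>_def vec_eq_iff forall_2)
  have \<phi>_p: "\<phi> (p i) = (X i, Y i)" for i by (simp add: \<phi>_def X_def Y_def)
  \<comment> \<open>The parameter \<open>s\<close> is not confined to the unit interval, so this
    also covers the line beyond the segment.\<close>
  have \<phi>_combination: "\<phi> ((1 - s) *\<^sub>R p (lo e) + s *\<^sub>R p (hi e)) = (L.line e y, y)"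
    if e: "e \<in> M" and y: "y = (1 - s) * a e + s * b e" for e s y
  proof -
    have "be e * (Y (hi e) - Y (lo e)) = X (hi e) - X (lo e)" using ends(2)[OF e] by (simp add: be_def)
    moreover have "L.line e y = X (lo e) + s * (be e * (Y (hi e) - Y (lo e)))"
      unfolding L.line_def al_def y a_def b_def by (simp add: algebra_simps)
    ultimately have "L.line e y = X (lo e) + s * (X (hi e) - X (lo e))" by simp
    then have "L.line e y = (1 - s) * X (lo e) + s * X (hi e)" by (simp add: algebra_simps)
    then show ?thesis
      using y by (simp add: linear_add[OF lin] linear_scale[OF lin] \<phi>_p a_def b_def)
  qed
  have on_line: "\<exists>s. y = (1 - s) * a e + s * b e \<and> (a e \<le> y \<and> y \<le> b e \<longrightarrow> 0 \<le> s \<and> s \<le> 1)"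
    if "e \<in> M" for e y
  proof -
    have ab: "a e < b e" using ends(2)[OF that] by (simp add: a_def b_def)
    define s where "s = (y - a e) / (b e - a e)"
    have "s * (b e - a e) = y - a e" using ab by (simp add: s_def)
    then have "y = (1 - s) * a e + s * b e" by (simp add: algebra_simps)
    moreover have "a e \<le> y \<and> y \<le> b e \<longrightarrow> 0 \<le> s \<and> s \<le> 1" using ab by (simp add: s_def)
    ultimately show ?thesis by blast
  qed
  \<comment> \<open>Here general position enters: \<open>q\<close> on the line of an edge would be
    collinear with its two endpoints.\<close>
  have off_line: "L.line e (Y q) \<noteq> X q" if e: "e \<in> M" and q: "q \<in> {1..n}" "q \<notin> e" for e q
  proof
    assume *: "L.line e (Y q) = X q"
    obtain s where "Y q = (1 - s) * a e + s * b e" using on_line[OF e] by blast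
    then have "\<phi> ((1 - s) *\<^sub>R p (lo e) + s *\<^sub>R p (hi e)) = \<phi> (p q)"
      using \<phi>_combination[OF e] * \<phi>_p by metis
    then have "p q = (1 - s) *\<^sub>R p (lo e) + (1 - (1 - s)) *\<^sub>R p (hi e)" using \<phi>_inj by simp
    then have "collinear {p (lo e), p q, p (hi e)}" unfolding collinear_3_expand by blast
    moreover have "card {p (lo e), p q, p (hi e)} = 3"
    proof -
      have "lo e \<noteq> q" "hi e \<noteq> q" using q(2) mem_ends[OF e] by blast+
      moreover have "lo e \<noteq> hi e" using ends(2)[OF e] by fastforce
      ultimately have "card {lo e, q, hi e} = 3" by simp
      moreover have "inj_on p {lo e, q, hi e}"
        by (rule inj_on_subset[OF inj]) (use ends_n[OF e] q(1) in simp)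
      ultimately show ?thesis using card_image[of p "{lo e, q, hi e}"] by simp
    qed
    moreover have "{p (lo e), p q, p (hi e)} \<subseteq> p ` {1..n}" using ends_n[OF e] q(1) by blast
    ultimately show False using gen unfolding general_position_def by blast
  qed
  \<comment> \<open>Strictly above all points, so every segment has started and every unmatched
    point is covered; the inserted \<open>0\<close> keeps the maximum defined for
    \<open>n = 0\<close>.\<close>
  define h where "h = Max (insert 0 (Y ` {1..n})) + 1"
  have h: "Y i < h" if "i \<in> {1..n}" for i
  proof -
    have "Y i \<le> Max (insert 0 (Y ` {1..n}))" using that by (intro Max_ge) auto
    then show ?thesis by (simp add: h_def)
  qed
  have lo_other: "lo e \<notin> e'" if "e \<in> M" "e' \<in> M" "e \<noteq> e'" for e e'
    using disj[OF that] mem_ends[OF that(1)] by blast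
  have "\<exists>A KK. sweep_cells al be a b M h A KK"
  proof (rule L.sweep_cells_exist[OF fin])
    show "a e < h" if "e \<in> M" for e using h ends_n[OF that] by (simp add: a_def)
    show "inj_on a M"
    proof (rule inj_onI, rule ccontr)
      fix e e' assume e: "e \<in> M" "e' \<in> M" "a e = a e'" "e \<noteq> e'"
      have "lo e \<noteq> lo e'" using lo_other[OF e(1,2,4)] mem_ends[OF e(2)] by blast
      then show False using Y_inj ends_n e unfolding a_def by blast
    qed
    \<comment> \<open>A meeting within both height ranges is a common point of two drawn edges,
      which share no label.\<close>
    show "L.line e y \<noteq> L.line e' y" if e: "e \<in> M" "e' \<in> M" "e \<noteq> e'"
      and y: "a e \<le> y" "y \<le> b e" "a e' \<le> y" "y \<le> b e'" for e e' y
    proof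
      assume *: "L.line e y = L.line e' y"
      obtain s where s: "y = (1 - s) * a e + s * b e" "0 \<le> s" "s \<le> 1" using on_line[OF e(1)] y by blast
      obtain s' where s': "y = (1 - s') * a e' + s' * b e'" "0 \<le> s'" "s' \<le> 1"
        using on_line[OF e(2)] y by blast
      have "(1 - s) *\<^sub>R p (lo e) + s *\<^sub>R p (hi e) = (1 - s') *\<^sub>R p (lo e') + s' *\<^sub>R p (hi e')"
        using \<phi>_combination[OF e(1) s(1)] \<phi>_combination[OF e(2) s'(1)] * by (intro \<phi>_inj) simp
      then have "closed_segment (p (lo e)) (p (hi e)) \<inter> closed_segment (p (lo e')) (p (hi e')) \<noteq> {}"
        using s s' unfolding closed_segment_def by blast
      moreover have "closed_segment (p (lo e)) (p (hi e)) \<inter> closed_segment (p (lo e')) (p (hi e'))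
          \<subseteq> p ` ({lo e, hi e} \<inter> {lo e', hi e'})"
        using cf e ends(1) unfolding crossing_free_def by metis
      moreover have "{lo e, hi e} \<inter> {lo e', hi e'} = {}"
        using disj[OF e] mem_ends[OF e(1)] mem_ends[OF e(2)] by blast
      ultimately show False by simp
    qed
    show "L.line e (a e) \<noteq> L.line e' (a e)" if e: "e \<in> M" "e' \<in> M" "e \<noteq> e'" for e e'
    proof -
      have "L.line e (a e) = X (lo e)" by (simp add: L.line_def al_def a_def)
      then show ?thesis using off_line[OF e(2) _ lo_other[OF e]] ends_n[OF e(1)] by (simp add: a_def)
    qed
  qed
  then obtain A KK where "sweep_cells al be a b M h A KK" by blast
  then interpret V: sweep_cells al be a b M h A KK .
  show thesis
  proof (rule that[of "(\<lambda>K. \<phi> -` K) ` KK"])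
    show "finite ((\<lambda>K. \<phi> -` K) ` KK)" using V.finite_cells by simp
    show "card ((\<lambda>K. \<phi> -` K) ` KK) \<le> card M + 1"
      using card_image_le[OF V.finite_cells] V.card_cells order_trans by blast
    show "convex K" if "K \<in> (\<lambda>K. \<phi> -` K) ` KK" for K
      using that V.convex_cell lin by (auto intro: convex_linear_vimage)
    show "closed_segment (p u) (p v) \<inter> K = {}" if K: "K \<in> (\<lambda>K. \<phi> -` K) ` KK" and uv: "{u, v} \<in> M" for K u v
    proof -
      obtain C where C: "C \<in> KK" "K = \<phi> -` C" using K by blast
      define e where "e = {u, v}"
      have e: "e \<in> M" using uv by (simp add: e_def)
      have "closed_segment (p u) (p v) = closed_segment (p (lo e)) (p (hi e))"
      proof -
        have "{u, v} = {lo e, hi e}" using ends(1)[OF e] unfolding e_def .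
        then show ?thesis by (auto simp: doubleton_eq_iff closed_segment_commute)
      qed
      moreover have "x \<notin> K" if x: "x \<in> closed_segment (p (lo e)) (p (hi e))" for x
      proof -
        obtain s where s: "x = (1 - s) *\<^sub>R p (lo e) + s *\<^sub>R p (hi e)" "0 \<le> s" "s \<le> 1"
          using x by (auto simp: closed_segment_def)
        define y where "y = (1 - s) * a e + s * b e"
        have ab: "a e \<le> b e" using ends(2)[OF e] by (simp add: a_def b_def)
        have "0 \<le> s * (b e - a e)" "0 \<le> (1 - s) * (b e - a e)" using ab s(2,3) by simp_all
        moreover have "y = a e + s * (b e - a e)" "y = b e - (1 - s) * (b e - a e)"
          by (simp_all add: y_def algebra_simps)
        ultimately have "a e \<le> y" "y \<le> b e" by linarith+
        then have "(L.line e y, y) \<notin> C" using V.avoids[OF C(1) e] by blast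
        then show ?thesis using \<phi>_combination[OF e y_def] s(1) C(2) by simp
      qed
      ultimately show ?thesis by blast
    qed
    show "\<exists>K\<in>(\<lambda>K. \<phi> -` K) ` KK. p q \<in> K" if q: "q \<in> {1..n} - \<Union>M" for q
    proof -
      have "L.off M (Y q) (X q)" unfolding L.off_def
      proof
        fix e assume "e \<in> M"
        then show "X q \<noteq> L.line e (Y q)" using off_line[of e q] q by auto
      qed
      then obtain K where "K \<in> KK" "(X q, Y q) \<in> K"
        using V.covers[of "Y q" "X q"] less_imp_le[OF h[of q]] q by blast
      then show ?thesis using \<phi>_p[of q] by auto
    qed
  qed
qed

section \<open>Adding an edge and counting tuples of cells\<close>

lemma compatible_matching_insert:
  assumes "compatible_matching n l p M" "q \<in> {1..n} - \<Union>M" "q' \<in> {1..n} - \<Union>M" "q \<noteq> q'"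
    and disjoint: "\<And>i u v. i \<in> {1..l} \<Longrightarrow> {u, v} \<in> M \<Longrightarrow>
      closed_segment (p i q) (p i q') \<inter> closed_segment (p i u) (p i v) = {}"
  shows "compatible_matching n l p (insert {q, q'} M)"
proof -
  have "matching n (insert {q, q'} M)"
    using assms(1-4) by (auto simp: compatible_matching_def matching_def pairwise_insert disjnt_def)
  moreover have "crossing_free (p i) (insert {q, q'} M)" if i: "i \<in> {1..l}" for i
    unfolding crossing_free_def
  proof (intro allI impI, elim conjE)
    fix a b c d
    assume ab: "{a, b} \<in> insert {q, q'} M" and cd: "{c, d} \<in> insert {q, q'} M" and ne: "{a, b} \<noteq> {c, d}"
    \<comment> \<open>An edge may list its two labels in either order, with the same
      segment.\<close>
    have new: "closed_segment (p i u) (p i v) = closed_segment (p i q) (p i q')" if "{u, v} = {q, q'}" for u v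
      using that by (auto simp: doubleton_eq_iff closed_segment_commute)
    consider "{a, b} \<in> M" "{c, d} \<in> M" | "{a, b} = {q, q'}" "{c, d} \<in> M" | "{a, b} \<in> M" "{c, d} = {q, q'}"
      using ab cd ne by blast
    then show "closed_segment (p i a) (p i b) \<inter> closed_segment (p i c) (p i d) \<subseteq> p i ` ({a, b} \<inter> {c, d})"
    proof cases
      case 1
      then show ?thesis using assms(1) i ne unfolding compatible_matching_def crossing_free_def by blast
    next
      case 2 then show ?thesis using disjoint[OF i 2(2)] new by blast
    next
      case 3 then show ?thesis using disjoint[OF i 3(1)] new by blast
    qed
  qed
  ultimately show ?thesis by (simp add: compatible_matching_def)
qed

theorem theorem3:
  fixes n k l :: nat
    and P :: "nat \<Rightarrow> (real ^ 2) set"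
    and p :: "nat \<Rightarrow> nat \<Rightarrow> real ^ 2"
    and M :: "nat set set"
  assumes "n \<ge> 1" and "k \<ge> 1" and "l \<ge> 1"
    and "\<And>i. i \<in> {1..l} \<Longrightarrow> general_position (P i)"
    and "\<And>i. i \<in> {1..l} \<Longrightarrow> bij_betw (p i) {1..n} (P i)"
    and "n \<ge> k ^ l + 2 * k - 1"
    and "maximal_compatible_matching n l p M"
  shows "card M \<ge> k"
proof (rule ccontr)
  assume "\<not> k \<le> card M"
  then have small: "card M + 1 \<le> k" by simp
  have comp: "compatible_matching n l p M" using assms(7) by (simp add: maximal_compatible_matching_def)
  then have M: "matching n M" by (simp add: compatible_matching_def)
  define good where "good i KK \<longleftrightarrow> finite KK \<and> card KK \<le> card M + 1 \<and> (\<forall>K\<in>KK. convex K) \<and>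
      (\<forall>K\<in>KK. \<forall>u v. {u, v} \<in> M \<longrightarrow> closed_segment (p i u) (p i v) \<inter> K = {}) \<and>
      (\<forall>q\<in>{1..n} - \<Union>M. \<exists>K\<in>KK. p i q \<in> K)" for i and KK :: "(real ^ 2) set set"
  have "\<exists>KK. good i KK" if i: "i \<in> {1..l}" for i
  proof -
    have bij: "inj_on (p i) {1..n}" "p i ` {1..n} = P i"
      using assms(5)[OF i] by (auto simp: bij_betw_def)
    have "general_position (p i ` {1..n})" "crossing_free (p i) M"
      using bij(2) assms(4)[OF i] comp i by (simp_all add: compatible_matching_def)
    then obtain KK where "finite KK" "card KK \<le> card M + 1" "\<And>K. K \<in> KK \<Longrightarrow> convex K"
      "\<And>K u v. K \<in> KK \<Longrightarrow> {u, v} \<in> M \<Longrightarrow> closed_segment (p i u) (p i v) \<inter> K = {}"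
      "\<And>q. q \<in> {1..n} - \<Union>M \<Longrightarrow> \<exists>K\<in>KK. p i q \<in> K"
      using convex_cells_exist[OF M bij(1)] by metis
    then have "good i KK" unfolding good_def by simp
    then show ?thesis ..
  qed
  then obtain KK where KK: "\<And>i. i \<in> {1..l} \<Longrightarrow> good i (KK i)" by metis
  define Q where "Q = {1..n} - \<Union>M"
  have "\<exists>K. K \<in> KK i \<and> p i q \<in> K" if "i \<in> {1..l}" "q \<in> Q" for i q
    using KK[OF that(1)] that(2) unfolding good_def Q_def by blast
  then obtain cell where cell: "\<And>i q. i \<in> {1..l} \<Longrightarrow> q \<in> Q \<Longrightarrow> cell i q \<in> KK i \<and> p i q \<in> cell i q"
    by metis
  \<comment> \<open>The tuple of chosen cells, restricted to \<open>{1..l}\<close> so that it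
    belongs to a finite product.\<close>
  define F where "F q = (\<lambda>i\<in>{1..l}. cell i q)" for q
  have fin: "finite (Pi\<^sub>E {1..l} KK)"
    using KK by (intro finite_PiE) (auto simp: good_def)
  have "F ` Q \<subseteq> Pi\<^sub>E {1..l} KK" using cell by (auto simp: F_def)
  then have "card (F ` Q) \<le> card (Pi\<^sub>E {1..l} KK)" using fin by (rule card_mono[rotated])
  also have "\<dots> = (\<Prod>i\<in>{1..l}. card (KK i))" by (simp add: card_PiE)
  also have "\<dots> \<le> (\<Prod>i\<in>{1..l}. k)"
    using KK small by (intro prod_mono) (force simp: good_def)
  also have "\<dots> = k ^ l" by simp
  \<comment> \<open>At most \<open>2 * (k - 1)\<close> labels are matched, which leaves at least
    \<open>k ^ l + 1\<close> of them.\<close>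
  also have "\<dots> < card Q"
  proof -
    have "card (\<Union>M) \<le> (\<Sum>e\<in>M. card e)" by (rule card_Union_le_sum_card)
    also have "\<dots> = 2 * card M" using M by (simp add: matching_def)
    finally have "card (\<Union>M) \<le> 2 * card M" .
    moreover have "\<Union>M \<subseteq> {1..n}" using M by (auto simp: matching_def)
    then have "card Q = n - card (\<Union>M)"
      unfolding Q_def by (subst card_Diff_subset) (auto intro: finite_subset)
    ultimately show ?thesis using assms(2,6) small by linarith
  qed
  finally have "\<not> inj_on F Q" by (rule pigeonhole)
  then obtain q q' where q: "q \<in> Q" "q' \<in> Q" "q \<noteq> q'" "F q = F q'" by (auto simp: inj_on_def)
  have "closed_segment (p i q) (p i q') \<inter> closed_segment (p i u) (p i v) = {}"
    if i: "i \<in> {1..l}" and uv: "{u, v} \<in> M" for i u v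
  proof -
    \<comment> \<open>Equal tuples give a common cell in drawing \<open>i\<close>; it is convex and
      misses all edges of \<open>M\<close>, so the new segment does too.\<close>
    have "cell i q = cell i q'" using q(4) i unfolding F_def by (metis restrict_apply')
    then have in_cell: "p i q \<in> cell i q" "p i q' \<in> cell i q" "cell i q \<in> KK i"
      using cell[OF i] q by auto
    then have "convex (cell i q)" "closed_segment (p i u) (p i v) \<inter> cell i q = {}"
      using KK[OF i] uv unfolding good_def by blast+
    then show ?thesis using in_cell unfolding convex_contains_segment by blast
  qed
  then have "compatible_matching n l p (insert {q, q'} M)"
    using q comp unfolding Q_def by (intro compatible_matching_insert) auto
  moreover have "{q, q'} \<notin> M" using q unfolding Q_def by blast
  ultimately show False using assms(7) by (simp add: maximal_compatible_matching_def)
qed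

end
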